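(* Let $F,G\in H\otimes H$ be twists on a quasi-bialgebra $(H,\Delta,\epsilon,\Phi)$. Then the twisted structures induced by $F$ and $G$ coincide (i.e. $\Delta_F=\Delta_G$ and $\Phi_F=\Phi_G$) if and only if there exists a compatible twist $C\in H\otimes H$ such that $G=FC$.
   Context: A quasi-bialgebra $(H,\Delta,\epsilon,\Phi)$ over a field $k$ is a unital associative $k$-algebra $H$ with algebra homomorphisms $\epsilon:H\to k$, $\Delta:H\to H\otimes H$ and an invertible $\Phi\in H\otimes H\otimes H$ such that (with $1$ also denoting the identity map) $(1\otimes\Delta)\Delta(a)=\Phi^{-1}(\Delta\otimes 1)\Delta(a)\Phi$ for all $a\in H$; $(\Delta\otimes 1\otimes 1)\Phi\cdot(1\otimes 1\otimes\Delta)\Phi=(\Phi\otimes 1)\cdot(1\otimes\Delta\otimes 1)\Phi\cdot(1\otimes\Phi)$; $(\epsilon\otimes 1)\Delta=1=(1\otimes\epsilon)\Delta$; $(1\otimes\epsilon\otimes 1)\Phi=1$. A twist is an invertible $F\in H\otimes H$ with $(\epsilon\otimes 1)F=(1\otimes\epsilon)F=1$. The twisted structure induced by $F$ is the quasi-bialgebra with the same $\epsilon$ and with $\Delta_F(a)=F\Delta(a)F^{-1}$, $\Phi_F=(F\otimes 1)\cdot(\Delta\otimes 1)F\cdot\Phi\cdot(1\otimes\Delta)F^{-1}\cdot(1\otimes F^{-1})$. A twist $C\in H\otimes H$ is called compatible if (i) $C$ commutes with the co-product, $C\Delta(a)=\Delta(a)C$ for all $a\in H$, and (ii) $C$ satisfies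 the quasi-cocycle condition $(C\otimes 1)\cdot(\Delta\otimes 1)C\cdot\Phi=\Phi\cdot(1\otimes C)\cdot(1\otimes\Delta)C$. *)

theory Defs
  imports Complex_Main "HOL-Library.Poly_Mapping"
begin

section \<open>Formal linear combinations\<close>

definition fscale :: "'k::field \<Rightarrow> ('a \<Rightarrow>\<^sub>0 'k) \<Rightarrow> ('a \<Rightarrow>\<^sub>0 'k)" where
  "fscale c p = Poly_Mapping.map ((*) c) p"

definition linext :: "('a \<Rightarrow> ('b \<Rightarrow>\<^sub>0 'k::field)) \<Rightarrow> ('a \<Rightarrow>\<^sub>0 'k) \<Rightarrow> ('b \<Rightarrow>\<^sub>0 'k)" where
  "linext f p = (\<Sum>w\<in>Poly_Mapping.keys p. fscale (Poly_Mapping.lookup p w) (f w))"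

abbreviation basis :: "'a \<Rightarrow> ('a \<Rightarrow>\<^sub>0 'k::field)" where
  "basis w \<equiv> Poly_Mapping.single w 1"

lemma lookup_fscale [simp]:
  "Poly_Mapping.lookup (fscale c p) w = c * Poly_Mapping.lookup p w"
  by (simp add: fscale_def map.rep_eq when_def)

interpretation formal: vector_space "fscale :: 'k::field \<Rightarrow> ('a \<Rightarrow>\<^sub>0 'k) \<Rightarrow> _"
  by standard (auto intro!: poly_mapping_eqI simp: lookup_add algebra_simps)


section \<open>Tensor powers of an algebra\<close>

locale k_algebra = vector_space scale
  for scale :: "'k::field \<Rightarrow> 'h::ring_1 \<Rightarrow> 'h" +
  assumes scale_mult_left: "scale c (x * y) = scale c x * y"
    and scale_mult_right: "scale c (x * y) = x * scale c y"
begin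

text \<open>
  The space of formal linear combinations of words over \<open>H\<close>, modulo the multilinearity
  relations, is the direct sum of all tensor powers of \<open>H\<close>. The \<open>n\<close>-th power
  consists of the classes of combinations of words of length \<open>n\<close>, the word
  \<open>[x\<^sub>1, \<dots>, x\<^sub>n]\<close> standing for the pure tensor \<open>x\<^sub>1 \<otimes> \<dots> \<otimes> x\<^sub>n\<close>. In particular
  the powers \<open>0\<close> and \<open>1\<close> are copies of \<open>k\<close> and \<open>H\<close>.
\<close>

definition multilinear_rels :: "('h list \<Rightarrow>\<^sub>0 'k) set" where
  "multilinear_rels =
     {basis (u @ (x + y) # v) - basis (u @ x # v) - basis (u @ y # v) | u x y v. True} \<union>
     {basis (u @ scale c x # v) - fscale c (basis (u @ x # v)) | u c x v. True}"

definition tclass :: "('h list \<Rightarrow>\<^sub>0 'k) \<Rightarrow> ('h list \<Rightarrow>\<^sub>0 'k) set" where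
  "tclass p = {q. q - p \<in> formal.span multilinear_rels}"

definition trep :: "('h list \<Rightarrow>\<^sub>0 'k) set \<Rightarrow> ('h list \<Rightarrow>\<^sub>0 'k)" where
  "trep A = (SOME p. p \<in> A)"

definition tpower :: "nat \<Rightarrow> ('h list \<Rightarrow>\<^sub>0 'k) set set" where
  "tpower n = tclass ` {p. \<forall>w\<in>Poly_Mapping.keys p. length w = n}"

definition tadd :: "('h list \<Rightarrow>\<^sub>0 'k) set \<Rightarrow> ('h list \<Rightarrow>\<^sub>0 'k) set \<Rightarrow> ('h list \<Rightarrow>\<^sub>0 'k) set"
    (infixl "\<oplus>" 65) where
  "A \<oplus> B = tclass (trep A + trep B)"

definition tscale :: "'k \<Rightarrow> ('h list \<Rightarrow>\<^sub>0 'k) set \<Rightarrow> ('h list \<Rightarrow>\<^sub>0 'k) set" where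
  "tscale c A = tclass (fscale c (trep A))"

text \<open>
  The factorwise product of the algebra \<open>H\<^sup>\<otimes>\<^sup>n\<close>. A representative of a class in
  \<open>tpower n\<close> may contain relations of other lengths; words of different
  lengths therefore have product \<open>0\<close>, which makes the product well defined on classes.
\<close>

definition fmult :: "('h list \<Rightarrow>\<^sub>0 'k) \<Rightarrow> ('h list \<Rightarrow>\<^sub>0 'k) \<Rightarrow> ('h list \<Rightarrow>\<^sub>0 'k)" where
  "fmult p q =
     linext (\<lambda>u. linext (\<lambda>v. if length u = length v then basis (map2 (*) u v) else 0) q) p"

definition tmult :: "('h list \<Rightarrow>\<^sub>0 'k) set \<Rightarrow> ('h list \<Rightarrow>\<^sub>0 'k) set \<Rightarrow> ('h list \<Rightarrow>\<^sub>0 'k) set"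
    (infixl "\<odot>" 70) where
  "A \<odot> B = tclass (fmult (trep A) (trep B))"

definition tone :: "nat \<Rightarrow> ('h list \<Rightarrow>\<^sub>0 'k) set" where
  "tone n = tclass (basis (replicate n 1))"

definition tinverse_of :: "nat \<Rightarrow> ('h list \<Rightarrow>\<^sub>0 'k) set \<Rightarrow> ('h list \<Rightarrow>\<^sub>0 'k) set \<Rightarrow> bool" where
  "tinverse_of n A B \<longleftrightarrow> B \<in> tpower n \<and> A \<odot> B = tone n \<and> B \<odot> A = tone n"

definition tinvertible :: "nat \<Rightarrow> ('h list \<Rightarrow>\<^sub>0 'k) set \<Rightarrow> bool" where
  "tinvertible n A \<longleftrightarrow> A \<in> tpower n \<and> (\<exists>B. tinverse_of n A B)"

definition tinv :: "nat \<Rightarrow> ('h list \<Rightarrow>\<^sub>0 'k) set \<Rightarrow> ('h list \<Rightarrow>\<^sub>0 'k) set" where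
  "tinv n A = (THE B. tinverse_of n A B)"

definition fconcat :: "('h list \<Rightarrow>\<^sub>0 'k) \<Rightarrow> ('h list \<Rightarrow>\<^sub>0 'k) \<Rightarrow> ('h list \<Rightarrow>\<^sub>0 'k)" where
  "fconcat p q = linext (\<lambda>u. linext (\<lambda>v. basis (u @ v)) q) p"

definition tensor :: "('h list \<Rightarrow>\<^sub>0 'k) set \<Rightarrow> ('h list \<Rightarrow>\<^sub>0 'k) set \<Rightarrow> ('h list \<Rightarrow>\<^sub>0 'k) set"
    (infixr "\<otimes>" 75) where
  "A \<otimes> B = tclass (fconcat (trep A) (trep B))"

text \<open>The identifications of \<open>k\<close> and \<open>H\<close> with the tensor powers \<open>0\<close> and \<open>1\<close>.\<close>

definition scalar_tensor :: "'k \<Rightarrow> ('h list \<Rightarrow>\<^sub>0 'k) set" where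
  "scalar_tensor c = tclass (fscale c (basis []))"

definition \<iota> :: "'h \<Rightarrow> ('h list \<Rightarrow>\<^sub>0 'k) set" where
  "\<iota> x = tclass (basis [x])"

text \<open>
  \<open>tmap [f\<^sub>1, \<dots>, f\<^sub>n]\<close> is the map \<open>f\<^sub>1 \<otimes> \<dots> \<otimes> f\<^sub>n\<close> on the \<open>n\<close>-th tensor power, where each
  \<open>f\<^sub>i\<close> is a linear map from \<open>H\<close> into some tensor power. The identity map of \<open>H\<close> is
  represented by \<open>\<iota>\<close>. Words of length other than \<open>n\<close> are sent to \<open>0\<close>, for the same reason
  as in the definition of \<open>fmult\<close>.
\<close>

definition tmap :: "('h \<Rightarrow> ('h list \<Rightarrow>\<^sub>0 'k) set) list \<Rightarrow>
    ('h list \<Rightarrow>\<^sub>0 'k) set \<Rightarrow> ('h list \<Rightarrow>\<^sub>0 'k) set" where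
  "tmap fs A = tclass (linext (\<lambda>w.
     if length w = length fs
     then foldr fconcat (map2 (\<lambda>f x. trep (f x)) fs w) (basis []) else 0) (trep A))"

end


section \<open>Quasi-bialgebras and twists\<close>

locale quasi_bialgebra = k_algebra scale
  for scale :: "'k::field \<Rightarrow> 'h::ring_1 \<Rightarrow> 'h" +
  fixes \<Delta> :: "'h \<Rightarrow> ('h list \<Rightarrow>\<^sub>0 'k) set"
    and \<epsilon> :: "'h \<Rightarrow> 'k"
    and \<Phi> :: "('h list \<Rightarrow>\<^sub>0 'k) set"
  assumes counit_add: "\<epsilon> (a + b) = \<epsilon> a + \<epsilon> b"
    and counit_scale: "\<epsilon> (scale c a) = c * \<epsilon> a"
    and counit_mult: "\<epsilon> (a * b) = \<epsilon> a * \<epsilon> b"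
    and counit_one: "\<epsilon> 1 = 1"
    and coproduct_closed: "\<Delta> a \<in> tpower 2"
    and coproduct_add: "\<Delta> (a + b) = \<Delta> a \<oplus> \<Delta> b"
    and coproduct_scale: "\<Delta> (scale c a) = tscale c (\<Delta> a)"
    and coproduct_mult: "\<Delta> (a * b) = \<Delta> a \<odot> \<Delta> b"
    and coproduct_one: "\<Delta> 1 = tone 2"
    and associator_invertible: "tinvertible 3 \<Phi>"
    and quasi_coassoc:
      "tmap [\<iota>, \<Delta>] (\<Delta> a) = tinv 3 \<Phi> \<odot> tmap [\<Delta>, \<iota>] (\<Delta> a) \<odot> \<Phi>"
    and pentagon:
      "tmap [\<Delta>, \<iota>, \<iota>] \<Phi> \<odot> tmap [\<iota>, \<iota>, \<Delta>] \<Phi> =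
       (\<Phi> \<otimes> tone 1) \<odot> tmap [\<iota>, \<Delta>, \<iota>] \<Phi> \<odot> (tone 1 \<otimes> \<Phi>)"
    and counit_left: "tmap [\<lambda>x. scalar_tensor (\<epsilon> x), \<iota>] (\<Delta> a) = \<iota> a"
    and counit_right: "tmap [\<iota>, \<lambda>x. scalar_tensor (\<epsilon> x)] (\<Delta> a) = \<iota> a"
    and counit_associator: "tmap [\<iota>, \<lambda>x. scalar_tensor (\<epsilon> x), \<iota>] \<Phi> = tone 2"
begin

definition twist :: "('h list \<Rightarrow>\<^sub>0 'k) set \<Rightarrow> bool" where
  "twist F \<longleftrightarrow> tinvertible 2 F \<and>
     tmap [\<lambda>x. scalar_tensor (\<epsilon> x), \<iota>] F = tone 1 \<and>
     tmap [\<iota>, \<lambda>x. scalar_tensor (\<epsilon> x)] F = tone 1"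

definition twisted_coproduct ::
    "('h list \<Rightarrow>\<^sub>0 'k) set \<Rightarrow> 'h \<Rightarrow> ('h list \<Rightarrow>\<^sub>0 'k) set" where
  "twisted_coproduct F a = F \<odot> \<Delta> a \<odot> tinv 2 F"

definition twisted_associator ::
    "('h list \<Rightarrow>\<^sub>0 'k) set \<Rightarrow> ('h list \<Rightarrow>\<^sub>0 'k) set" where
  "twisted_associator F =
     (F \<otimes> tone 1) \<odot> tmap [\<Delta>, \<iota>] F \<odot> \<Phi> \<odot> tmap [\<iota>, \<Delta>] (tinv 2 F) \<odot> (tone 1 \<otimes> tinv 2 F)"

definition compatible_twist :: "('h list \<Rightarrow>\<^sub>0 'k) set \<Rightarrow> bool" where
  "compatible_twist C \<longleftrightarrow> twist C \<and>
     (\<forall>a. C \<odot> \<Delta> a = \<Delta> a \<odot> C) \<and>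
     (C \<otimes> tone 1) \<odot> tmap [\<Delta>, \<iota>] C \<odot> \<Phi> = \<Phi> \<odot> (tone 1 \<otimes> C) \<odot> tmap [\<iota>, \<Delta>] C"

end

end

theory Submission
  imports Defs
begin

text \<open>
  Twists of \<open>H \<otimes> H\<close> form a group under \<open>\<odot>\<close>, so \<open>G = F \<odot> C\<close> for the twist
  \<open>C = F\<^sup>-\<^sup>1 \<odot> G\<close> and for no other \<open>C\<close>. It must be seen that \<open>F\<close> and \<open>F \<odot> C\<close> induce the same structure
  exactly when \<open>C\<close> is compatible (\<open>twisted_structures_eq_iff_compatible\<close>).
  
  Twisting by \<open>F \<odot> C\<close> conjugates the coproduct first by \<open>C\<close> and then by \<open>F\<close>. Cancelling the outer
  conjugation, the coproducts agree iff conjugation by \<open>C\<close> fixes \<open>\<Delta>\<close>, that is, iff \<open>C\<close>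
  commutes with \<open>\<Delta>\<close>. For the associator, put \<open>L F = (F \<otimes> 1) \<odot> (\<Delta> \<otimes> 1) F\<close> and
  \<open>R F = (1 \<otimes> F) \<odot> (1 \<otimes> \<Delta>) F\<close>, so that the twisted associator is \<open>L F \<odot> \<Phi> \<odot> (R F)\<^sup>-\<^sup>1\<close>. In
  general \<open>L\<close> and \<open>R\<close> are not multiplicative, but if \<open>C\<close> commutes with \<open>\<Delta>\<close>, then \<open>C \<otimes> 1\<close> can be moved past
  \<open>(\<Delta> \<otimes> 1) F\<close>, and likewise \<open>1 \<otimes> C\<close> past \<open>(1 \<otimes> \<Delta>) F\<close>; hence \<open>L (F \<odot> C) = L F \<odot> L C\<close> and the same for
  \<open>R\<close>. The factors of \<open>F\<close> then cancel, and equality of the associators becomes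
  \<open>L C \<odot> \<Phi> = \<Phi> \<odot> R C\<close>, the quasi-cocycle condition.
  
  Most of the work lies in the calculus of tensor powers behind this. Tensors are classes of
  formal combinations of words, and every operation on them chooses representatives. The
  operations are well defined because they are linear extensions of maps on words that respect
  the multilinearity relations (\<open>tclass_linext_cong\<close>). After that only two facts are needed:
  the operations are linear in each argument, and every tensor power is spanned by pure tensors
  (\<open>tpower_induct\<close>). They reduce each identity to a computation with words, in particular the
  multiplicativity of \<open>f\<^sub>1 \<otimes> \<dots> \<otimes> f\<^sub>n\<close> for algebra homomorphisms \<open>f\<^sub>i\<close> (\<open>tmap_tmult\<close>).
\<close>

section \<open>Linear extension\<close>

lemma linext_eq_sum:
  assumes "finite S" "Poly_Mapping.keys p \<subseteq> S"
  shows "linext f p = (\<Sum>w\<in>S. fscale (Poly_Mapping.lookup p w) (f w))"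
  unfolding linext_def
  by (rule sum.mono_neutral_left) (use assms in \<open>auto simp: in_keys_iff\<close>)

lemma linext_zero [simp]: "linext f 0 = 0"
  by (simp add: linext_def)

lemma linext_add: "linext f (p + q) = linext f p + linext f q"
proof -
  let ?S = "Poly_Mapping.keys p \<union> Poly_Mapping.keys q"
  have "Poly_Mapping.keys (p + q) \<subseteq> ?S"
    by (rule Poly_Mapping.keys_add)
  then show ?thesis
    by (simp add: linext_eq_sum[of ?S] lookup_add formal.scale_left_distrib sum.distrib)
qed

lemma linext_fscale: "linext f (fscale c p) = fscale c (linext f p)"
proof -
  have "Poly_Mapping.keys (fscale c p) \<subseteq> Poly_Mapping.keys p"
    by (auto simp: in_keys_iff)
  then show ?thesis
    by (simp add: linext_eq_sum[of "Poly_Mapping.keys p"] formal.scale_sum_right)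
qed

lemma linext_diff: "linext f (p - q) = linext f p - linext f q"
  using linext_add[of f "p - q" q] by simp

lemma linext_basis [simp]: "linext f (basis w) = f w"
  by (simp add: linext_def)

lemma linext_cong:
  "(\<And>w. w \<in> Poly_Mapping.keys p \<Longrightarrow> f w = g w) \<Longrightarrow> linext f p = linext g p"
  by (simp add: linext_def)

lemma linext_id: "linext basis p = p"
proof (rule poly_mapping_eqI)
  fix w
  have "Poly_Mapping.lookup (linext basis p) w =
      (\<Sum>v\<in>Poly_Mapping.keys p. Poly_Mapping.lookup p v * (1 when v = w))"
    by (simp add: linext_def lookup_sum lookup_single)
  also have "\<dots> = Poly_Mapping.lookup p w"
    by (auto simp: when_def if_distrib[of "(*) _"] in_keys_iff cong: if_cong)
  finally show "Poly_Mapping.lookup (linext basis p) w = Poly_Mapping.lookup p w" .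
qed

lemma linext_fun_add: "linext (\<lambda>w. f w + g w) p = linext f p + linext g p"
  by (simp add: linext_def formal.scale_right_distrib sum.distrib)

lemma linext_fun_fscale: "linext (\<lambda>w. fscale c (f w)) p = fscale c (linext f p)"
  by (simp add: linext_def formal.scale_sum_right mult.commute)

lemma linext_linext: "linext f (linext g p) = linext (\<lambda>w. linext f (g w)) p"
proof -
  have "linext f (sum h S) = (\<Sum>w\<in>S. linext f (h w))" for h S
    by (induction S rule: infinite_finite_induct) (auto simp: linext_add)
  then have "linext f (linext g p) =
      (\<Sum>w\<in>Poly_Mapping.keys p. linext f (fscale (Poly_Mapping.lookup p w) (g w)))"
    by (simp only: linext_def[of g])
  then show ?thesis
    by (simp only: linext_fscale linext_def[of "\<lambda>w. linext f (g w)"])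
qed

lemma linext_swap:
  "linext (\<lambda>u. linext (f u) q) p = linext (\<lambda>v. linext (\<lambda>u. f u v) p) q"
  unfolding linext_def
  by (simp add: formal.scale_sum_right mult.commute) (rule sum.swap)

section \<open>Operations on classes of representatives\<close>

context k_algebra
begin

lemma tclass_eq_iff: "tclass p = tclass q \<longleftrightarrow> p - q \<in> formal.span multilinear_rels"
proof
  assume "tclass p = tclass q"
  moreover have "p \<in> tclass p"
    by (simp add: tclass_def formal.span_zero)
  ultimately show "p - q \<in> formal.span multilinear_rels"
    by (auto simp: tclass_def)
next
  assume pq: "p - q \<in> formal.span multilinear_rels"
  have "r - p \<in> formal.span multilinear_rels \<longleftrightarrow> r - q \<in> formal.span multilinear_rels" for r
    using formal.span_add[OF _ pq, of "r - p"] formal.span_diff[OF _ pq, of "r - q"]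
    by auto
  then show "tclass p = tclass q"
    by (auto simp: tclass_def)
qed

lemma tclass_trep_tclass [simp]: "tclass (trep (tclass p)) = tclass p"
proof -
  have "p \<in> tclass p"
    by (simp add: tclass_def formal.span_zero)
  then have "trep (tclass p) \<in> tclass p"
    unfolding trep_def by (rule someI)
  then show ?thesis
    unfolding tclass_eq_iff by (simp add: tclass_def)
qed

lemma tclass_add_cong:
  assumes "tclass p = tclass p'" "tclass q = tclass q'"
  shows "tclass (p + q) = tclass (p' + q')"
proof -
  have "(p - p') + (q - q') \<in> formal.span multilinear_rels"
    using assms by (intro formal.span_add) (simp_all add: tclass_eq_iff)
  then show ?thesis
    by (simp add: tclass_eq_iff algebra_simps)
qed

lemma tclass_fscale_cong:
  assumes "tclass p = tclass p'"
  shows "tclass (fscale c p) = tclass (fscale c p')"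
proof -
  have "fscale c (p - p') \<in> formal.span multilinear_rels"
    using assms by (intro formal.span_scale) (simp_all add: tclass_eq_iff)
  then show ?thesis
    by (simp add: tclass_eq_iff formal.scale_right_diff_distrib)
qed

lemma tclass_add: "tclass (p + q) = tclass p \<oplus> tclass q"
  unfolding tadd_def by (intro tclass_add_cong) simp_all

lemma tclass_fscale: "tclass (fscale c p) = tscale c (tclass p)"
  unfolding tscale_def by (intro tclass_fscale_cong) simp

lemma multilinear_rels_cases:
  assumes "r \<in> multilinear_rels"
  obtains
    (add) u x y v where "r = basis (u @ (x + y) # v) - basis (u @ x # v) - basis (u @ y # v)"
  | (scale) u c x v where "r = basis (u @ scale c x # v) - fscale c (basis (u @ x # v))"
  using assms unfolding multilinear_rels_def by blast

lemma basis_multilinear: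
  "tclass (basis (u @ (x + y) # v)) = tclass (basis (u @ x # v) + basis (u @ y # v))"
  "tclass (basis (u @ scale c x # v)) = tclass (fscale c (basis (u @ x # v)))"
  unfolding tclass_eq_iff multilinear_rels_def diff_diff_eq[symmetric]
  by (blast intro!: formal.span_base)+

text \<open>
  A map on words whose linear extension descends to classes.
\<close>

definition respects_rels :: "('h list \<Rightarrow> ('h list \<Rightarrow>\<^sub>0 'k)) \<Rightarrow> bool" where
  "respects_rels h \<longleftrightarrow>
     (\<forall>u x y v. tclass (h (u @ (x + y) # v)) = tclass (h (u @ x # v) + h (u @ y # v))) \<and>
     (\<forall>u c x v. tclass (h (u @ scale c x # v)) = tclass (fscale c (h (u @ x # v))))"

lemma tclass_linext_cong:
  assumes h: "respects_rels h" and pq: "tclass p = tclass q"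
  shows "tclass (linext h p) = tclass (linext h q)"
proof -
  have "linext h r \<in> formal.span multilinear_rels" if "r \<in> formal.span multilinear_rels" for r
    using that
  proof (induction r rule: formal.span_induct_alt)
    case base
    show ?case by (simp add: formal.span_zero)
  next
    case (step c r s)
    from step(1) have "linext h r \<in> formal.span multilinear_rels"
    proof (cases rule: multilinear_rels_cases)
      case (add u x y v)
      then show ?thesis
        using h by (simp add: respects_rels_def tclass_eq_iff linext_diff linext_add diff_diff_eq)
    next
      case (scale u c x v)
      then show ?thesis
        using h by (simp add: respects_rels_def tclass_eq_iff linext_diff linext_fscale)
    qed
    then show ?case
      using step(2) by (simp add: linext_add linext_fscale formal.span_add formal.span_scale)
  qed
  then show ?thesis
    using pq by (simp add: tclass_eq_iff linext_diff[symmetric])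
qed

lemma tclass_linext_fun_cong:
  assumes "\<And>w. w \<in> Poly_Mapping.keys p \<Longrightarrow> tclass (f w) = tclass (g w)"
  shows "tclass (linext f p) = tclass (linext g p)"
proof -
  have "tclass (\<Sum>w\<in>S. fscale (c w) (f w)) = tclass (\<Sum>w\<in>S. fscale (c w) (g w))"
    if "\<And>w. w \<in> S \<Longrightarrow> tclass (f w) = tclass (g w)" for S c
    using that
    by (induction S rule: infinite_finite_induct)
      (auto intro!: tclass_add_cong tclass_fscale_cong)
  then show ?thesis
    unfolding linext_def using assms by blast
qed

lemma respects_rels_linext:
  assumes "\<And>v. respects_rels (\<lambda>u. h u v)"
  shows "respects_rels (\<lambda>u. linext (h u) q)"
  using assms unfolding respects_rels_def linext_fun_add[symmetric] linext_fun_fscale[symmetric]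
  by (auto intro!: tclass_linext_fun_cong)

text \<open>
  The letter of \<open>v\<close> opposite the varied letter is a fixed second argument of \<open>f\<close>, and changing a
  letter does not change the length test, so both relations come from the linearity
  of \<open>f\<close> in its first argument.
\<close>

lemma respects_rels_map2:
  assumes add: "\<And>x y z. f (x + y) z = f x z + f y z"
    and scale: "\<And>c x z. f (scale c x) z = scale c (f x z)"
  shows "respects_rels (\<lambda>u. if length u = length v then basis (map2 f u v) else 0)"
proof -
  have split: "map2 f (a @ x # b) v =
      map2 f a (take (length a) v) @ f x (v ! length a) # map2 f b (drop (Suc (length a)) v)"
    if "Suc (length a + length b) = length v" for a b x
  proof -
    have "v = take (length a) v @ v ! length a # drop (Suc (length a)) v"
      using that by (intro id_take_nth_drop) simp
    then have "map2 f (a @ x # b) v =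
        map2 f (a @ x # b) (take (length a) v @ v ! length a # drop (Suc (length a)) v)"
      by simp
    also have "\<dots> = map2 f a (take (length a) v) @ f x (v ! length a) #
        map2 f b (drop (Suc (length a)) v)"
      using that by (subst zip_append) simp_all
    finally show ?thesis .
  qed
  show ?thesis
    by (simp add: respects_rels_def split add scale basis_multilinear)
qed

lemma tmult_tclass: "tclass p \<odot> tclass q = tclass (fmult p q)"
proof -
  have left: "tclass (fmult p q) = tclass (fmult p' q)" if "tclass p = tclass p'" for p p' q
    unfolding fmult_def using that
    by (intro tclass_linext_cong respects_rels_linext respects_rels_map2)
      (simp_all add: algebra_simps scale_mult_left)
  (* Well-definedness in the right factor is the left one for the opposite product. *)
  have right: "tclass (fmult p q) = tclass (fmult p q')" if "tclass q = tclass q'" for p q q'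
  proof -
    have "respects_rels (\<lambda>v. if length u = length v then basis (map2 (*) u v) else 0)" for u
    proof -
      have "map2 (\<lambda>x y. y * x) v u = map2 (*) u v" for v :: "'h list"
        by (subst zip_commute) (simp add: case_prod_beta)
      moreover have
        "respects_rels (\<lambda>v. if length v = length u then basis (map2 (\<lambda>x y. y * x) v u) else 0)"
        by (rule respects_rels_map2) (simp_all add: algebra_simps scale_mult_right)
      ultimately show ?thesis
        by (simp add: eq_commute[of _ "length u"] cong: if_cong)
    qed
    then show ?thesis
      unfolding fmult_def linext_swap[of _ q] linext_swap[of _ q']
      using that by (intro tclass_linext_cong respects_rels_linext)
  qed
  show ?thesis
    unfolding tmult_def using left right by (metis tclass_trep_tclass)
qed

lemma tensor_tclass: "tclass p \<otimes> tclass q = tclass (fconcat p q)"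
proof -
  have left: "tclass (fconcat p q) = tclass (fconcat p' q)" if "tclass p = tclass p'" for p p' q
    unfolding fconcat_def using that
    by (intro tclass_linext_cong respects_rels_linext) (simp_all add: respects_rels_def basis_multilinear)
  have right: "tclass (fconcat p q) = tclass (fconcat p q')" if "tclass q = tclass q'" for p q q'
    unfolding fconcat_def linext_swap[of _ q] linext_swap[of _ q'] using that
    by (intro tclass_linext_cong respects_rels_linext)
      (simp_all add: respects_rels_def basis_multilinear flip: append_assoc)
  show ?thesis
    unfolding tensor_def using left right by (metis tclass_trep_tclass)
qed

text \<open>
  The product and the tensor product are defined on arbitrary sets of formal combinations,
  through the chosen representatives; well-definedness on classes lets a sum of representatives
  be expanded, so bilinearity holds even for sets that are not classes. This keeps the
  linear steps of inductions over tensors free of side conditions.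
\<close>

lemma bilinear_on_classes:
  assumes def: "\<And>A B. T A B = tclass (linext (\<lambda>u. linext (h u) (trep B)) (trep A))"
    and tclass: "\<And>p q. T (tclass p) (tclass q) = tclass (linext (\<lambda>u. linext (h u) q) p)"
  shows "T (A \<oplus> B) C = T A C \<oplus> T B C"
    and "T A (B \<oplus> C) = T A B \<oplus> T A C"
    and "T (tscale c A) B = tscale c (T A B)"
    and "T A (tscale c B) = tscale c (T A B)"
proof -
  have rep: "T A B = T (tclass (trep A)) (tclass (trep B))" for A B
    unfolding tclass by (rule def)
  have left: "T (tclass p) B = tclass (linext (\<lambda>u. linext (h u) (trep B)) p)" for p B
    by (subst rep) (simp add: tclass)
  have right: "T A (tclass q) = tclass (linext (\<lambda>u. linext (h u) q) (trep A))" for A q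
    by (subst rep) (simp add: tclass)
  show "T (A \<oplus> B) C = T A C \<oplus> T B C"
    (* tclass_add only after left: otherwise it would split the argument of T itself. *)
    unfolding tadd_def[of A B] left linext_add unfolding tclass_add unfolding def ..
  show "T A (B \<oplus> C) = T A B \<oplus> T A C"
    unfolding tadd_def[of B C] right linext_add linext_fun_add unfolding tclass_add unfolding def ..
  show "T (tscale c A) B = tscale c (T A B)"
    unfolding tscale_def[of c A] left linext_fscale unfolding tclass_fscale unfolding def ..
  show "T A (tscale c B) = tscale c (T A B)"
    unfolding tscale_def[of c B] right linext_fscale linext_fun_fscale unfolding tclass_fscale unfolding def ..
qed

lemmas tmult_bilinear =
  bilinear_on_classes[of "(\<odot>)", OF tmult_def[unfolded fmult_def] tmult_tclass[unfolded fmult_def]]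

lemmas tensor_bilinear =
  bilinear_on_classes[of "(\<otimes>)", OF tensor_def[unfolded fconcat_def] tensor_tclass[unfolded fconcat_def]]

section \<open>Tensor powers as algebras spanned by pure tensors\<close>

abbreviation pure :: "'h list \<Rightarrow> ('h list \<Rightarrow>\<^sub>0 'k) set" where
  "pure w \<equiv> tclass (basis w)"

lemma pure_mult: "length u = length v \<Longrightarrow> pure u \<odot> pure v = pure (map2 (*) u v)"
  by (simp add: tmult_tclass fmult_def)

lemma pure_tensor: "pure u \<otimes> pure v = pure (u @ v)"
  by (simp add: tensor_tclass fconcat_def)

lemma pure_closed: "length w = n \<Longrightarrow> pure w \<in> tpower n"
  unfolding tpower_def by (rule imageI) simp

lemma tone_closed [simp]: "tone n \<in> tpower n"
  by (simp add: tone_def pure_closed)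

lemma tadd_closed:
  assumes "A \<in> tpower n" "B \<in> tpower n"
  shows "A \<oplus> B \<in> tpower n"
proof -
  obtain p q where p: "A = tclass p" "\<forall>w\<in>Poly_Mapping.keys p. length w = n"
    and q: "B = tclass q" "\<forall>w\<in>Poly_Mapping.keys q. length w = n"
    using assms unfolding tpower_def by blast
  have "\<forall>w\<in>Poly_Mapping.keys (p + q). length w = n"
    using p(2) q(2) Poly_Mapping.keys_add[of p q] by blast
  then show ?thesis
    unfolding tpower_def p(1) q(1) tclass_add[symmetric] by blast
qed

lemma tscale_closed:
  assumes "A \<in> tpower n"
  shows "tscale c A \<in> tpower n"
proof -
  obtain p where p: "A = tclass p" "\<forall>w\<in>Poly_Mapping.keys p. length w = n"
    using assms unfolding tpower_def by blast
  have "\<forall>w\<in>Poly_Mapping.keys (fscale c p). length w = n"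
    using p(2) by (auto simp: in_keys_iff)
  then show ?thesis
    unfolding tpower_def p(1) tclass_fscale[symmetric] by blast
qed

text \<open>
  The zero tensor is covered by the case \<open>scale\<close>, as the multiple by \<open>0\<close> of any pure tensor.
\<close>

lemma tpower_induct [consumes 1, case_names pure add scale]:
  assumes "A \<in> tpower n"
    and pure: "\<And>w. length w = n \<Longrightarrow> P (pure w)"
    and add: "\<And>A B. A \<in> tpower n \<Longrightarrow> B \<in> tpower n \<Longrightarrow> P A \<Longrightarrow> P B \<Longrightarrow> P (A \<oplus> B)"
    and scale: "\<And>c A. A \<in> tpower n \<Longrightarrow> P A \<Longrightarrow> P (tscale c A)"
  shows "P A"
proof -
  obtain p where p: "A = tclass p" "\<forall>w\<in>Poly_Mapping.keys p. length w = n"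
    using assms(1) unfolding tpower_def by blast
  have zero: "tclass 0 = tscale 0 (pure (replicate n 1))"
    by (simp add: tclass_fscale[symmetric])
  have "tclass (\<Sum>w\<in>S. fscale (c w) (basis w)) \<in> tpower n \<and>
      P (tclass (\<Sum>w\<in>S. fscale (c w) (basis w)))" if "\<forall>w\<in>S. length w = n" for S c
    using that
    by (induction S rule: infinite_finite_induct)
      (auto simp: zero tclass_add tclass_fscale
        intro!: pure add scale tadd_closed tscale_closed pure_closed)
  then have "P (tclass (linext basis p))"
    unfolding linext_def using p(2) by blast
  then show ?thesis
    by (simp add: linext_id p(1))
qed

lemma tmult_closed:
  assumes "A \<in> tpower n" "B \<in> tpower n"
  shows "A \<odot> B \<in> tpower n"
  using assms(1)
proof (induction A rule: tpower_induct)
  case (pure u)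
  show ?case
    using assms(2)
    by (induction B rule: tpower_induct)
      (simp_all add: pure pure_mult tmult_bilinear pure_closed tadd_closed tscale_closed)
qed (simp_all add: tmult_bilinear tadd_closed tscale_closed)

lemma tensor_closed:
  assumes "A \<in> tpower m" "B \<in> tpower n"
  shows "A \<otimes> B \<in> tpower (m + n)"
  using assms(1)
proof (induction A rule: tpower_induct)
  case (pure u)
  show ?case
    using assms(2)
    by (induction B rule: tpower_induct)
      (simp_all add: pure pure_tensor tensor_bilinear pure_closed tadd_closed tscale_closed)
qed (simp_all add: tensor_bilinear tadd_closed tscale_closed)

lemma tmult_tone_left: "A \<in> tpower n \<Longrightarrow> tone n \<odot> A = A"
proof (induction A rule: tpower_induct)
  case (pure w)
  have "map2 (*) (replicate n 1) w = w"
    using pure by (intro nth_equalityI) simp_all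
  then show ?case
    using pure by (simp add: tone_def pure_mult)
qed (simp_all add: tmult_bilinear)

lemma tmult_tone_right: "A \<in> tpower n \<Longrightarrow> A \<odot> tone n = A"
proof (induction A rule: tpower_induct)
  case (pure w)
  have "map2 (*) w (replicate n 1) = w"
    using pure by (intro nth_equalityI) simp_all
  then show ?case
    using pure by (simp add: tone_def pure_mult)
qed (simp_all add: tmult_bilinear)

text \<open>
  If three words have the same length, this is associativity letter by letter; otherwise both
  bracketings give \<open>0\<close>.
\<close>

lemma fmult_assoc: "fmult (fmult p q) r = fmult p (fmult q r)"
proof -
  let ?m = "\<lambda>u v. if length u = length v then basis (map2 (*) u v) else 0 :: 'h list \<Rightarrow>\<^sub>0 'k"
  have map: "map2 (*) (map2 (*) u v) w = map2 (*) u (map2 (*) v w)" for u v w :: "'h list"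
    by (intro nth_equalityI) (simp_all add: mult.assoc)
  have zero: "linext (\<lambda>w. 0) r = (0 :: 'h list \<Rightarrow>\<^sub>0 'k)"
    by (simp add: linext_def)
  have word: "linext (\<lambda>u. linext (?m u) r) (?m u v) = linext (\<lambda>w. linext (?m u) (?m v w)) r" for u v
  proof (cases "length u = length v")
    case True
    then show ?thesis
      by (auto simp: map intro!: linext_cong)
  next
    case False
    then have "linext (?m u) (?m v w) = 0" for w
      by auto
    then show ?thesis
      using False by (simp add: zero)
  qed
  show ?thesis
    unfolding fmult_def linext_linext word ..
qed

text \<open>
  Associativity holds for arbitrary sets, as an outer product only sees the class
  of a chosen representative.
\<close>

lemma tmult_assoc: "A \<odot> B \<odot> C = A \<odot> (B \<odot> C)"
proof -
  have rep: "tclass (trep X) \<odot> tclass (trep Y) = X \<odot> Y" for X Y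
    unfolding tmult_tclass by (rule tmult_def[symmetric])
  have trep: "tclass (trep (X \<odot> Y)) = X \<odot> Y" for X Y
    by (simp add: tmult_def)
  have "A \<odot> B \<odot> tclass (trep C) = tclass (trep A) \<odot> (B \<odot> C)"
    using tmult_tclass[of "fmult (trep A) (trep B)" "trep C"]
      tmult_tclass[of "trep A" "fmult (trep B) (trep C)"]
    by (simp add: tmult_def[of A B] tmult_def[of B C] fmult_assoc)
  then show ?thesis
    using rep[of "A \<odot> B" C] rep[of A "B \<odot> C"] by (simp add: trep)
qed

lemma tensor_tmult:
  assumes "A \<in> tpower m" "A' \<in> tpower m" "B \<in> tpower n" "B' \<in> tpower n"
  shows "(A \<otimes> B) \<odot> (A' \<otimes> B') = (A \<odot> A') \<otimes> (B \<odot> B')"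
  using assms(1)
proof (induction A rule: tpower_induct)
  case u: (pure u)
  show ?case
    using assms(2)
  proof (induction A' rule: tpower_induct)
    case u': (pure u')
    show ?case
      using assms(3)
    proof (induction B rule: tpower_induct)
      case v: (pure v)
      show ?case
        using assms(4)
      proof (induction B' rule: tpower_induct)
        case (pure v')
        then show ?case
          by (simp add: u u' v pure_tensor pure_mult)
      qed (simp_all add: tmult_bilinear tensor_bilinear)
    qed (simp_all add: tmult_bilinear tensor_bilinear)
  qed (simp_all add: tmult_bilinear tensor_bilinear)
qed (simp_all add: tmult_bilinear tensor_bilinear)

lemma tensor_tone: "tone m \<otimes> tone n = tone (m + n)"
  by (simp add: tone_def pure_tensor replicate_add)

lemma tensor_tone_0: "A \<in> tpower n \<Longrightarrow> A \<otimes> tone 0 = A"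
  by (induction A rule: tpower_induct) (simp_all add: tone_def pure_tensor tensor_bilinear)

section \<open>Tensor products of algebra homomorphisms\<close>

definition tensor_linear :: "('h \<Rightarrow> ('h list \<Rightarrow>\<^sub>0 'k) set) \<Rightarrow> bool" where
  "tensor_linear f \<longleftrightarrow> (\<forall>x y. f (x + y) = f x \<oplus> f y) \<and> (\<forall>c x. f (scale c x) = tscale c (f x))"

definition tensor_hom :: "nat \<Rightarrow> ('h \<Rightarrow> ('h list \<Rightarrow>\<^sub>0 'k) set) \<Rightarrow> bool" where
  "tensor_hom n f \<longleftrightarrow> tensor_linear f \<and> (\<forall>x. f x \<in> tpower n) \<and>
     (\<forall>x y. f (x * y) = f x \<odot> f y) \<and> f 1 = tone n"

text \<open>
  The value of \<open>f\<^sub>1 \<otimes> \<dots> \<otimes> f\<^sub>n\<close> on a pure tensor.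
\<close>

abbreviation tensor_images ::
    "('h \<Rightarrow> ('h list \<Rightarrow>\<^sub>0 'k) set) list \<Rightarrow> 'h list \<Rightarrow> ('h list \<Rightarrow>\<^sub>0 'k) set" where
  "tensor_images fs w \<equiv> foldr (\<otimes>) (map2 (\<lambda>f x. f x) fs w) (tone 0)"

lemma tensor_images_multilinear:
  assumes "list_all tensor_linear fs" "length fs = Suc (length u + length v)"
  shows "tensor_images fs (u @ (x + y) # v) =
           tensor_images fs (u @ x # v) \<oplus> tensor_images fs (u @ y # v)"
    and "tensor_images fs (u @ scale c x # v) = tscale c (tensor_images fs (u @ x # v))"
proof -
  have "tensor_images fs (u @ (x + y) # v) =
           tensor_images fs (u @ x # v) \<oplus> tensor_images fs (u @ y # v) \<and>
        tensor_images fs (u @ scale c x # v) = tscale c (tensor_images fs (u @ x # v))"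
    using assms
  proof (induction u arbitrary: fs)
    case Nil
    then obtain g gs where "fs = g # gs"
      by (cases fs) simp_all
    then show ?case
      using Nil by (simp add: tensor_linear_def tensor_bilinear)
  next
    case (Cons a u)
    then obtain g gs where "fs = g # gs"
      by (cases fs) simp_all
    then show ?case
      using Cons by (simp add: tensor_bilinear)
  qed
  then show "tensor_images fs (u @ (x + y) # v) =
           tensor_images fs (u @ x # v) \<oplus> tensor_images fs (u @ y # v)"
    and "tensor_images fs (u @ scale c x # v) = tscale c (tensor_images fs (u @ x # v))"
    by blast+
qed

lemma tclass_foldr_fconcat:
  "tclass (foldr fconcat (map2 (\<lambda>f x. trep (f x)) fs w) (basis [])) = tensor_images fs w"
proof (induction fs w rule: list_induct2')
  case (4 f fs x w)
  have "tclass (fconcat (trep (f x)) q) = f x \<otimes> tclass q" for q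
  proof -
    have "tclass (fconcat (trep (f x)) q) = tclass (trep (f x)) \<otimes> tclass (trep (tclass q))"
      by (simp add: tensor_tclass)
    also have "\<dots> = f x \<otimes> tclass q"
      unfolding tensor_tclass by (rule tensor_def[symmetric])
    finally show ?thesis .
  qed
  then show ?case
    using 4 by simp
qed (simp_all add: tone_def)

lemma tmap_tclass:
  assumes "list_all tensor_linear fs"
  shows "tmap fs (tclass p) = tclass (linext (\<lambda>w.
     if length w = length fs
     then foldr fconcat (map2 (\<lambda>f x. trep (f x)) fs w) (basis []) else 0) p)"
    (is "_ = tclass (linext ?h p)")
proof -
  have "tclass 0 \<oplus> tclass 0 = tclass 0" "tscale c (tclass 0) = tclass 0" for c
    by (simp_all flip: tclass_add tclass_fscale)
  then have "respects_rels ?h"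
    using assms
    by (simp add: respects_rels_def tclass_add tclass_fscale tclass_foldr_fconcat
        tensor_images_multilinear)
  then show ?thesis
    unfolding tmap_def by (rule tclass_linext_cong) simp
qed

lemma tmap_pure:
  assumes "list_all tensor_linear fs" "length w = length fs"
  shows "tmap fs (pure w) = tensor_images fs w"
  using assms by (simp add: tmap_tclass tclass_foldr_fconcat)

lemma tmap_tadd:
  assumes "list_all tensor_linear fs"
  shows "tmap fs (A \<oplus> B) = tmap fs A \<oplus> tmap fs B"
  unfolding tadd_def[of A B] tmap_tclass[OF assms] linext_add unfolding tclass_add
  unfolding tmap_def ..

lemma tmap_tscale:
  assumes "list_all tensor_linear fs"
  shows "tmap fs (tscale c A) = tscale c (tmap fs A)"
  unfolding tscale_def[of c A] tmap_tclass[OF assms] linext_fscale unfolding tclass_fscale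
  unfolding tmap_def ..

lemma tensor_hom_linear: "list_all2 tensor_hom ms fs \<Longrightarrow> list_all tensor_linear fs"
  by (induction ms fs rule: list_all2_induct) (simp_all add: tensor_hom_def)

lemma tensor_images_closed:
  assumes "list_all2 tensor_hom ms fs" "length w = length fs"
  shows "tensor_images fs w \<in> tpower (sum_list ms)"
  using assms
proof (induction ms fs arbitrary: w rule: list_all2_induct)
  case Nil
  then show ?case by simp
next
  case (Cons m ms f fs)
  obtain x v where w: "w = x # v" "length v = length fs"
    using Cons.prems by (auto simp: length_Suc_conv)
  have "f x \<in> tpower m"
    using Cons.hyps by (simp add: tensor_hom_def)
  from tensor_closed[OF this Cons.IH[OF w(2)]] show ?case
    by (simp add: w)
qed

text \<open>
  Since \<open>f\<close> and the remaining factors take values in fixed tensor powers, the two products have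
  matching factors, and the interchange law \<open>tensor_tmult\<close> gives the induction step.
\<close>

lemma tensor_images_mult:
  assumes "list_all2 tensor_hom ms fs" "length u = length fs" "length v = length fs"
  shows "tensor_images fs (map2 (*) u v) = tensor_images fs u \<odot> tensor_images fs v"
  using assms
proof (induction ms fs arbitrary: u v rule: list_all2_induct)
  case Nil
  then show ?case
    by (simp add: tmult_tone_left)
next
  case (Cons m ms f fs)
  obtain x u' y v' where uv: "u = x # u'" "v = y # v'"
    using Cons.prems by (auto simp: length_Suc_conv)
  have f: "f x \<in> tpower m" "f y \<in> tpower m" "f (x * y) = f x \<odot> f y"
    using Cons.hyps by (simp_all add: tensor_hom_def)
  have "tensor_images fs u' \<in> tpower (sum_list ms)" "tensor_images fs v' \<in> tpower (sum_list ms)"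
    using Cons.prems Cons.hyps by (auto simp: uv intro: tensor_images_closed)
  note tensor_tmult[OF f(1,2) this]
  then show ?case
    using Cons.prems Cons.IH by (simp add: uv f)
qed

lemma tensor_images_one:
  assumes "list_all2 tensor_hom ms fs"
  shows "tensor_images fs (replicate (length fs) 1) = tone (sum_list ms)"
  using assms
  by (induction ms fs rule: list_all2_induct) (simp_all add: tensor_hom_def tensor_tone)

lemma tmap_closed:
  assumes "list_all2 tensor_hom ms fs" "A \<in> tpower (length fs)"
  shows "tmap fs A \<in> tpower (sum_list ms)"
  using assms(2)
  by (induction A rule: tpower_induct)
    (simp_all add: assms(1) tmap_pure tmap_tadd tmap_tscale tensor_hom_linear[OF assms(1)]
      tensor_images_closed tadd_closed tscale_closed)

lemma tmap_tmult:
  assumes "list_all2 tensor_hom ms fs" "A \<in> tpower (length fs)" "B \<in> tpower (length fs)"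
  shows "tmap fs (A \<odot> B) = tmap fs A \<odot> tmap fs B"
  using assms(2)
proof (induction A rule: tpower_induct)
  case u: (pure u)
  show ?case
    using assms(3)
  proof (induction B rule: tpower_induct)
    case (pure v)
    then show ?case
      using u assms(1) tensor_hom_linear[OF assms(1)]
      by (simp add: pure_mult tmap_pure tensor_images_mult)
  qed (simp_all add: tmult_bilinear tmap_tadd tmap_tscale tensor_hom_linear[OF assms(1)])
qed (simp_all add: tmult_bilinear tmap_tadd tmap_tscale tensor_hom_linear[OF assms(1)])

lemma tmap_tone:
  assumes "list_all2 tensor_hom ms fs" "length fs = n"
  shows "tmap fs (tone n) = tone (sum_list ms)"
  using assms tensor_hom_linear[OF assms(1)] tensor_images_one[OF assms(1)]
  by (simp add: tone_def[of n] tmap_pure)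

lemma iota_closed: "\<iota> x \<in> tpower 1"
  by (simp add: \<iota>_def pure_closed)

lemma tensor_hom_iota: "tensor_hom 1 \<iota>"
  using basis_multilinear[of "[]" _ _ "[]"] basis_multilinear(2)[of "[]" _ _ "[]"]
  by (simp add: tensor_hom_def tensor_linear_def \<iota>_def pure_closed pure_mult tone_def
      tclass_add tclass_fscale)

lemma iota_tensor_tone_0: "\<iota> x \<otimes> tone 0 = \<iota> x"
  by (rule tensor_tone_0[OF iota_closed])

text \<open>
  On a pure tensor \<open>x \<otimes> y\<close> both sides are a product with \<open>f x \<otimes> y\<close>: the factor \<open>C\<close> meets only \<open>f x\<close>,
  with which it commutes, and \<open>1\<close> meets only \<open>y\<close>. Both sides are linear in \<open>A\<close>, so
  this suffices.
\<close>

lemma tmap_commute_left: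
  assumes f: "tensor_linear f" "\<And>x. f x \<in> tpower m" "\<And>x. C \<odot> f x = f x \<odot> C"
    and C: "C \<in> tpower m" and A: "A \<in> tpower 2"
  shows "(C \<otimes> tone 1) \<odot> tmap [f, \<iota>] A = tmap [f, \<iota>] A \<odot> (C \<otimes> tone 1)"
proof -
  have lin: "list_all tensor_linear [f, \<iota>]"
    using f(1) tensor_hom_iota by (simp add: tensor_hom_def)
  show ?thesis
    using A
  proof (induction A rule: tpower_induct)
    case (pure w)
    then obtain x y where w: "w = [x, y]"
      by (auto simp: numeral_2_eq_2 length_Suc_conv)
    show ?case
      using tensor_tmult[OF C f(2) tone_closed iota_closed] tensor_tmult[OF f(2) C iota_closed tone_closed]
      by (simp add: w tmap_pure[OF lin] iota_tensor_tone_0 f(3)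
         tmult_tone_left tmult_tone_right iota_closed del: One_nat_def)
  qed (simp_all add: tmult_bilinear tmap_tadd[OF lin] tmap_tscale[OF lin])
qed

lemma tmap_commute_right:
  assumes f: "tensor_linear f" "\<And>x. f x \<in> tpower m" "\<And>x. C \<odot> f x = f x \<odot> C"
    and C: "C \<in> tpower m" and A: "A \<in> tpower 2"
  shows "(tone 1 \<otimes> C) \<odot> tmap [\<iota>, f] A = tmap [\<iota>, f] A \<odot> (tone 1 \<otimes> C)"
proof -
  have lin: "list_all tensor_linear [\<iota>, f]"
    using f(1) tensor_hom_iota by (simp add: tensor_hom_def)
  show ?thesis
    using A
  proof (induction A rule: tpower_induct)
    case (pure w)
    then obtain x y where w: "w = [x, y]"
      by (auto simp: numeral_2_eq_2 length_Suc_conv)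
    show ?case
      using tensor_tmult[OF tone_closed iota_closed C f(2)] tensor_tmult[OF iota_closed tone_closed f(2) C]
      by (simp add: w tmap_pure[OF lin] tensor_tone_0[OF f(2)] f(3)
         tmult_tone_left tmult_tone_right iota_closed del: One_nat_def)
  qed (simp_all add: tmult_bilinear tmap_tadd[OF lin] tmap_tscale[OF lin])
qed

section \<open>Inverses\<close>

lemma tinverse_of_unique:
  assumes "tinverse_of n A B" "tinverse_of n A B'"
  shows "B = B'"
proof -
  have "B = B \<odot> tone n"
    using assms(1) by (simp add: tinverse_of_def tmult_tone_right)
  also have "\<dots> = B \<odot> A \<odot> B'"
    using assms(2) by (simp add: tinverse_of_def tmult_assoc)
  also have "\<dots> = B'"
    using assms by (simp add: tinverse_of_def tmult_tone_left)
  finally show ?thesis .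
qed

lemma tinv_eqI: "tinverse_of n A B \<Longrightarrow> tinv n A = B"
  unfolding tinv_def by (metis the_equality tinverse_of_unique)

lemma tinvertibleD:
  assumes "tinvertible n A"
  shows "A \<in> tpower n" "tinv n A \<in> tpower n" "A \<odot> tinv n A = tone n" "tinv n A \<odot> A = tone n"
    and "tinverse_of n A (tinv n A)"
proof -
  obtain B where B: "A \<in> tpower n" "tinverse_of n A B"
    using assms unfolding tinvertible_def by blast
  then show inv: "tinverse_of n A (tinv n A)"
    by (simp add: tinv_eqI)
  show "A \<in> tpower n" "tinv n A \<in> tpower n" "A \<odot> tinv n A = tone n" "tinv n A \<odot> A = tone n"
    using B(1) inv unfolding tinverse_of_def by simp_all
qed

lemma tinverse_of_cancel:
  assumes "tinverse_of n A A'" "X \<in> tpower n"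
  shows "A \<odot> (A' \<odot> X) = X" "A' \<odot> (A \<odot> X) = X"
  using assms by (simp_all add: tinverse_of_def tmult_tone_left flip: tmult_assoc)

lemma tinverse_of_mult:
  assumes "A \<in> tpower n" "tinverse_of n A A'" "B \<in> tpower n" "tinverse_of n B B'"
  shows "tinverse_of n (A \<odot> B) (B' \<odot> A')"
proof -
  have closed: "A' \<in> tpower n" "B' \<in> tpower n"
    using assms(2,4) by (simp_all add: tinverse_of_def)
  have "A \<odot> B \<odot> (B' \<odot> A') = A \<odot> (B \<odot> (B' \<odot> A'))"
    by (rule tmult_assoc)
  also have "\<dots> = tone n"
    using assms(2) tinverse_of_cancel(1)[OF assms(4) closed(1)] by (simp add: tinverse_of_def)
  finally have right: "A \<odot> B \<odot> (B' \<odot> A') = tone n" .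
  have "B' \<odot> A' \<odot> (A \<odot> B) = B' \<odot> (A' \<odot> (A \<odot> B))"
    by (rule tmult_assoc)
  also have "\<dots> = tone n"
    using assms(4) tinverse_of_cancel(2)[OF assms(2,3)] by (simp add: tinverse_of_def)
  finally show ?thesis
    using right tmult_closed[OF closed(2,1)] by (simp add: tinverse_of_def)
qed

lemma tinvertible_tmult:
  assumes "tinvertible n A" "tinvertible n B"
  shows "tinvertible n (A \<odot> B)"
proof -
  note A = tinvertibleD[OF assms(1)] and B = tinvertibleD[OF assms(2)]
  show ?thesis
    unfolding tinvertible_def using tmult_closed[OF A(1) B(1)] tinverse_of_mult[OF A(1,5) B(1,5)]
    by blast
qed

lemma tinv_tmult:
  assumes "tinvertible n A" "tinvertible n B"
  shows "tinv n (A \<odot> B) = tinv n B \<odot> tinv n A"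
  by (rule tinv_eqI tinverse_of_mult tinvertibleD(1,5) assms)+

lemma tinvertible_tinv:
  assumes "tinvertible n A"
  shows "tinvertible n (tinv n A)"
  using tinvertibleD(1-4)[OF assms] unfolding tinvertible_def tinverse_of_def by blast

lemma tinverse_of_tmap:
  assumes fs: "list_all2 tensor_hom ms fs" "length fs = n"
    and A: "A \<in> tpower n" "tinverse_of n A A'"
  shows "tinverse_of (sum_list ms) (tmap fs A) (tmap fs A')"
proof -
  have A': "A' \<in> tpower n" "A \<odot> A' = tone n" "A' \<odot> A = tone n"
    using A(2) by (simp_all add: tinverse_of_def)
  show ?thesis
    using A A' tmap_closed[OF fs(1), of A'] tmap_tone[OF fs]
      tmap_tmult[OF fs(1), of A A'] tmap_tmult[OF fs(1), of A' A]
    by (simp add: tinverse_of_def fs(2))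
qed

lemma tinverse_of_tensor:
  assumes "A \<in> tpower m" "tinverse_of m A A'" "B \<in> tpower n" "tinverse_of n B B'"
  shows "tinverse_of (m + n) (A \<otimes> B) (A' \<otimes> B')"
proof -
  have "A' \<in> tpower m" "B' \<in> tpower n"
    using assms by (simp_all add: tinverse_of_def)
  with assms show ?thesis
    unfolding tinverse_of_def
    by (simp add: tensor_tmult[of A m A' B n B'] tensor_tmult[of A' m A B' n B]
        tensor_tone tensor_closed)
qed

lemma tinverse_of_tone: "tinverse_of n (tone n) (tone n)"
  by (simp add: tinverse_of_def tmult_tone_left)

text \<open>
  Cancellation of invertible outer factors. With \<open>A = 1\<close> it also allows an equation to be
  multiplied on the right by an invertible element.
\<close>

lemma sandwich_eq_iff:
  assumes "tinverse_of n A A'" "tinverse_of n B B'" "A \<in> tpower n" "B \<in> tpower n"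
    "X \<in> tpower n" "Y \<in> tpower n"
  shows "A \<odot> X \<odot> B = A \<odot> Y \<odot> B \<longleftrightarrow> X = Y"
proof
  assume eq: "A \<odot> X \<odot> B = A \<odot> Y \<odot> B"
  have cancel: "A' \<odot> (A \<odot> Z \<odot> B) \<odot> B' = Z" if "Z \<in> tpower n" for Z
  proof -
    have "A' \<odot> (A \<odot> Z \<odot> B) \<odot> B' = A' \<odot> (A \<odot> (Z \<odot> (B \<odot> B')))"
      by (simp add: tmult_assoc)
    also have "Z \<odot> (B \<odot> B') = Z"
      using assms(2) that by (simp add: tinverse_of_def tmult_tone_right)
    finally show ?thesis
      by (simp add: tinverse_of_cancel(2)[OF assms(1) that])
  qed
  show "X = Y"
    using cancel[OF assms(5)] unfolding eq cancel[OF assms(6)] by (rule sym)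
qed simp

end

section \<open>Twisting by a product of twists\<close>

context quasi_bialgebra
begin

lemma tensor_hom_coproduct: "tensor_hom 2 \<Delta>"
  by (simp add: tensor_hom_def tensor_linear_def coproduct_closed coproduct_add coproduct_scale
      coproduct_mult coproduct_one)

lemma tensor_hom_counit: "tensor_hom 0 (\<lambda>x. scalar_tensor (\<epsilon> x))"
proof -
  have "scalar_tensor (\<epsilon> (x + y)) = scalar_tensor (\<epsilon> x) \<oplus> scalar_tensor (\<epsilon> y)" for x y
    by (simp add: scalar_tensor_def counit_add formal.scale_left_distrib tclass_add)
  moreover have "scalar_tensor (\<epsilon> (scale c x)) = tscale c (scalar_tensor (\<epsilon> x))" for c x
    by (simp add: scalar_tensor_def counit_scale flip: tclass_fscale)
  moreover have "scalar_tensor (\<epsilon> (x * y)) = scalar_tensor (\<epsilon> x) \<odot> scalar_tensor (\<epsilon> y)" for x y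
  proof -
    have "scalar_tensor (\<epsilon> x) \<odot> scalar_tensor (\<epsilon> y) = tscale (\<epsilon> x) (tscale (\<epsilon> y) (pure []))"
      by (simp add: scalar_tensor_def tclass_fscale tmult_bilinear pure_mult)
        (simp add: mult.commute flip: tclass_fscale)
    then show ?thesis
      by (simp add: scalar_tensor_def counit_mult flip: tclass_fscale)
  qed
  moreover have "scalar_tensor c \<in> tpower 0" for c
    by (simp add: scalar_tensor_def tclass_fscale tscale_closed pure_closed)
  moreover have "scalar_tensor (\<epsilon> 1) = tone 0"
    by (simp add: scalar_tensor_def counit_one tone_def)
  ultimately show ?thesis
    by (simp add: tensor_hom_def tensor_linear_def)
qed

lemma tensor_homs:
  "list_all2 tensor_hom [2, 1] [\<Delta>, \<iota>]"
  "list_all2 tensor_hom [1, 2] [\<iota>, \<Delta>]"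
  "list_all2 tensor_hom [0, 1] [\<lambda>x. scalar_tensor (\<epsilon> x), \<iota>]"
  "list_all2 tensor_hom [1, 0] [\<iota>, \<lambda>x. scalar_tensor (\<epsilon> x)]"
  using tensor_hom_coproduct tensor_hom_iota tensor_hom_counit by simp_all

lemma twistD: "twist F \<Longrightarrow> tinvertible 2 F"
  by (simp add: twist_def)

text \<open>
  Both counit conditions say that an algebra homomorphism \<open>H \<otimes> H \<rightarrow> H\<close> sends the twist to \<open>1\<close>;
  such a condition passes to inverses and products.
\<close>

lemma twist_inverse_mult:
  assumes "twist F" "twist G"
  shows "twist (tinv 2 F \<odot> G)"
proof -
  note F = tinvertibleD[OF twistD[OF assms(1)]] and G = tinvertibleD[OF twistD[OF assms(2)]]
  have inv: "tinvertible 2 (tinv 2 F \<odot> G)"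
    by (intro tinvertible_tmult tinvertible_tinv twistD assms)
  have counit: "tmap fs (tinv 2 F \<odot> G) = tone 1"
    if fs: "list_all2 tensor_hom ms fs" "length fs = 2" "sum_list ms = 1"
      and FG: "tmap fs F = tone 1" "tmap fs G = tone 1" for ms fs
  proof -
    have "tinverse_of 1 (tone 1) (tmap fs (tinv 2 F))"
      using tinverse_of_tmap[OF fs(1,2) F(1,5)] by (simp only: fs(3) FG)
    then have "tmap fs (tinv 2 F) = tone 1"
      by (rule tinverse_of_unique[OF _ tinverse_of_tone])
    then show ?thesis
      using F(2) G(1) fs FG by (simp add: tmap_tmult[OF fs(1)] tmult_tone_left del: One_nat_def)
  qed
  show ?thesis
    using inv counit[OF tensor_homs(3)] counit[OF tensor_homs(4)] assms
    unfolding twist_def by simp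
qed

lemma twisted_coproduct_closed:
  assumes "tinvertible 2 F"
  shows "twisted_coproduct F a \<in> tpower 2"
  unfolding twisted_coproduct_def using tinvertibleD[OF assms] coproduct_closed
  by (intro tmult_closed)

lemma twisted_coproduct_tmult:
  assumes "tinvertible 2 F" "tinvertible 2 C"
  shows "twisted_coproduct (F \<odot> C) a = F \<odot> twisted_coproduct C a \<odot> tinv 2 F"
  by (simp add: twisted_coproduct_def tinv_tmult assms tmult_assoc)

lemma twisted_coproduct_tmult_eq_iff:
  assumes F: "tinvertible 2 F" and C: "tinvertible 2 C"
  shows "twisted_coproduct (F \<odot> C) = twisted_coproduct F \<longleftrightarrow> (\<forall>a. C \<odot> \<Delta> a = \<Delta> a \<odot> C)"
proof -
  note Fi = tinvertibleD[OF F] and Ci = tinvertibleD[OF C]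
  have Fi': "tinverse_of 2 (tinv 2 F) F"
    using Fi by (simp add: tinverse_of_def)
  have "twisted_coproduct (F \<odot> C) a = twisted_coproduct F a \<longleftrightarrow> C \<odot> \<Delta> a = \<Delta> a \<odot> C" for a
  proof -
    have "twisted_coproduct (F \<odot> C) a = twisted_coproduct F a \<longleftrightarrow> twisted_coproduct C a = \<Delta> a"
      unfolding twisted_coproduct_tmult[OF F C] twisted_coproduct_def[of F]
      by (rule sandwich_eq_iff[OF Fi(5) Fi' Fi(1,2) twisted_coproduct_closed[OF C] coproduct_closed])
    (* Multiplying by C on the right turns conjugation by C into a commutation relation. *)
    also have "\<dots> \<longleftrightarrow> tone 2 \<odot> twisted_coproduct C a \<odot> C = tone 2 \<odot> \<Delta> a \<odot> C"
      by (rule sandwich_eq_iff[symmetric, OF tinverse_of_tone Ci(5) tone_closed Ci(1)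
            twisted_coproduct_closed[OF C] coproduct_closed])
    also have "\<dots> \<longleftrightarrow> C \<odot> \<Delta> a = \<Delta> a \<odot> C"
      using Ci coproduct_closed[of a]
      by (simp add: twisted_coproduct_def tmult_assoc tmult_tone_left tmult_tone_right tmult_closed)
    finally show ?thesis .
  qed
  then show ?thesis
    by (simp add: fun_eq_iff)
qed

text \<open>
  The element by which \<open>F\<close> multiplies the associator on the left.
\<close>

definition twist_left :: "('h list \<Rightarrow>\<^sub>0 'k) set \<Rightarrow> ('h list \<Rightarrow>\<^sub>0 'k) set" where
  "twist_left F = (F \<otimes> tone 1) \<odot> tmap [\<Delta>, \<iota>] F"

text \<open>
  The associator is multiplied on the right by the inverse of this element. The element itself,
  rather than its inverse, preserves the order of products of twists, as \<open>twist_left\<close> does.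
\<close>

definition twist_right :: "('h list \<Rightarrow>\<^sub>0 'k) set \<Rightarrow> ('h list \<Rightarrow>\<^sub>0 'k) set" where
  "twist_right F = (tone 1 \<otimes> F) \<odot> tmap [\<iota>, \<Delta>] F"

lemma twist_parts_closed:
  assumes "F \<in> tpower 2"
  shows "F \<otimes> tone 1 \<in> tpower 3" "tmap [\<Delta>, \<iota>] F \<in> tpower 3"
    and "tone 1 \<otimes> F \<in> tpower 3" "tmap [\<iota>, \<Delta>] F \<in> tpower 3"
  using assms tensor_closed[OF assms tone_closed[of 1]] tensor_closed[OF tone_closed[of 1] assms]
    tmap_closed[OF tensor_homs(1), of F] tmap_closed[OF tensor_homs(2), of F]
  by (simp_all add: numeral_2_eq_2 numeral_3_eq_3)

lemma twist_left_closed: "F \<in> tpower 2 \<Longrightarrow> twist_left F \<in> tpower 3"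
  unfolding twist_left_def by (intro tmult_closed twist_parts_closed)

lemma twist_right_closed: "F \<in> tpower 2 \<Longrightarrow> twist_right F \<in> tpower 3"
  unfolding twist_right_def by (intro tmult_closed twist_parts_closed)

lemma tinverse_of_twist_left:
  assumes "tinvertible 2 F"
  shows "tinverse_of 3 (twist_left F) (tmap [\<Delta>, \<iota>] (tinv 2 F) \<odot> (tinv 2 F \<otimes> tone 1))"
proof -
  note F = tinvertibleD[OF assms]
  have "tinverse_of 3 (F \<otimes> tone 1) (tinv 2 F \<otimes> tone 1)"
    using tinverse_of_tensor[OF F(1,5) tone_closed tinverse_of_tone, of 1]
    by (simp add: numeral_3_eq_3)
  moreover have "tinverse_of 3 (tmap [\<Delta>, \<iota>] F) (tmap [\<Delta>, \<iota>] (tinv 2 F))"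
    using tinverse_of_tmap[OF tensor_homs(1) _ F(1,5)] by simp
  ultimately show ?thesis
    unfolding twist_left_def by (intro tinverse_of_mult twist_parts_closed F)
qed

lemma tinverse_of_twist_right:
  assumes "tinvertible 2 F"
  shows "tinverse_of 3 (twist_right F) (tmap [\<iota>, \<Delta>] (tinv 2 F) \<odot> (tone 1 \<otimes> tinv 2 F))"
proof -
  note F = tinvertibleD[OF assms]
  have "tinverse_of 3 (tone 1 \<otimes> F) (tone 1 \<otimes> tinv 2 F)"
    using tinverse_of_tensor[OF tone_closed tinverse_of_tone F(1,5), of 1]
    by (simp add: numeral_3_eq_3)
  moreover have "tinverse_of 3 (tmap [\<iota>, \<Delta>] F) (tmap [\<iota>, \<Delta>] (tinv 2 F))"
    using tinverse_of_tmap[OF tensor_homs(2) _ F(1,5)] by (simp add: numeral_3_eq_3)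
  ultimately show ?thesis
    unfolding twist_right_def by (intro tinverse_of_mult twist_parts_closed F)
qed

lemma twisted_associator_eq:
  assumes "tinvertible 2 F"
  shows "twisted_associator F = twist_left F \<odot> \<Phi> \<odot> tinv 3 (twist_right F)"
  using tinv_eqI[OF tinverse_of_twist_right[OF assms]]
  by (simp add: twisted_associator_def twist_left_def tmult_assoc)

lemma coproduct_tensor_linear: "tensor_linear \<Delta>"
  using tensor_hom_coproduct by (simp add: tensor_hom_def)

text \<open>
  A plain expansion gives \<open>(F \<otimes> 1) (C \<otimes> 1) (\<Delta> \<otimes> 1)F (\<Delta> \<otimes> 1)C\<close>. Commutation of \<open>C\<close> with the coproduct
  is what permits the two middle factors to be exchanged.
\<close>

lemma twist_left_tmult:
  assumes F: "F \<in> tpower 2" and C: "C \<in> tpower 2" and comm: "\<And>a. C \<odot> \<Delta> a = \<Delta> a \<odot> C"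
  shows "twist_left (F \<odot> C) = twist_left F \<odot> twist_left C"
proof -
  have tensor: "(F \<odot> C) \<otimes> tone 1 = (F \<otimes> tone 1) \<odot> (C \<otimes> tone 1)"
    unfolding tensor_tmult[OF F C tone_closed tone_closed] tmult_tone_left[OF tone_closed] ..
  have map: "tmap [\<Delta>, \<iota>] (F \<odot> C) = tmap [\<Delta>, \<iota>] F \<odot> tmap [\<Delta>, \<iota>] C"
    by (rule tmap_tmult[OF tensor_homs(1)]) (use F C in \<open>simp_all add: numeral_2_eq_2\<close>)
  have "twist_left (F \<odot> C) =
      (F \<otimes> tone 1) \<odot> ((C \<otimes> tone 1) \<odot> tmap [\<Delta>, \<iota>] F) \<odot> tmap [\<Delta>, \<iota>] C"
    unfolding twist_left_def tensor map by (simp only: tmult_assoc)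
  also have "(C \<otimes> tone 1) \<odot> tmap [\<Delta>, \<iota>] F = tmap [\<Delta>, \<iota>] F \<odot> (C \<otimes> tone 1)"
    by (rule tmap_commute_left[OF coproduct_tensor_linear coproduct_closed comm C F])
  finally show ?thesis
    by (simp add: twist_left_def tmult_assoc)
qed

lemma twist_right_tmult:
  assumes F: "F \<in> tpower 2" and C: "C \<in> tpower 2" and comm: "\<And>a. C \<odot> \<Delta> a = \<Delta> a \<odot> C"
  shows "twist_right (F \<odot> C) = twist_right F \<odot> twist_right C"
proof -
  have tensor: "tone 1 \<otimes> (F \<odot> C) = (tone 1 \<otimes> F) \<odot> (tone 1 \<otimes> C)"
    unfolding tensor_tmult[OF tone_closed tone_closed F C] tmult_tone_left[OF tone_closed] ..
  have map: "tmap [\<iota>, \<Delta>] (F \<odot> C) = tmap [\<iota>, \<Delta>] F \<odot> tmap [\<iota>, \<Delta>] C"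
    by (rule tmap_tmult[OF tensor_homs(2)]) (use F C in \<open>simp_all add: numeral_2_eq_2\<close>)
  have "twist_right (F \<odot> C) =
      (tone 1 \<otimes> F) \<odot> ((tone 1 \<otimes> C) \<odot> tmap [\<iota>, \<Delta>] F) \<odot> tmap [\<iota>, \<Delta>] C"
    unfolding twist_right_def tensor map by (simp only: tmult_assoc)
  also have "(tone 1 \<otimes> C) \<odot> tmap [\<iota>, \<Delta>] F = tmap [\<iota>, \<Delta>] F \<odot> (tone 1 \<otimes> C)"
    by (rule tmap_commute_right[OF coproduct_tensor_linear coproduct_closed comm C F])
  finally show ?thesis
    by (simp add: twist_right_def tmult_assoc)
qed

text \<open>
  Commutation of \<open>C\<close> with the coproduct separates the contributions of \<open>F\<close> and \<open>C\<close>: the associator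
  twisted by \<open>F \<odot> C\<close> is the one twisted by \<open>C\<close>, between the outer factors of \<open>F\<close>. These cancel.
\<close>

lemma twisted_associator_tmult_eq_iff:
  assumes F: "tinvertible 2 F" and C: "tinvertible 2 C"
    and comm: "\<And>a. C \<odot> \<Delta> a = \<Delta> a \<odot> C"
  shows "twisted_associator (F \<odot> C) = twisted_associator F \<longleftrightarrow>
    twist_left C \<odot> \<Phi> = \<Phi> \<odot> twist_right C"
proof -
  have left: "tinvertible 3 (twist_left A)" if "tinvertible 2 A" for A
    using tinverse_of_twist_left[OF that] twist_left_closed[OF tinvertibleD(1)[OF that]]
    unfolding tinvertible_def by blast
  have right: "tinvertible 3 (twist_right A)" if "tinvertible 2 A" for A
    using tinverse_of_twist_right[OF that] twist_right_closed[OF tinvertibleD(1)[OF that]]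
    unfolding tinvertible_def by blast
  note closed = tinvertibleD(1)[OF F] tinvertibleD(1)[OF C]
    and LF = tinvertibleD[OF left[OF F]] and RF = tinvertibleD[OF right[OF F]]
    and LC = tinvertibleD[OF left[OF C]] and RC = tinvertibleD[OF right[OF C]]
    and \<Phi> = tinvertibleD(1)[OF associator_invertible]
  have RF': "tinverse_of 3 (tinv 3 (twist_right F)) (twist_right F)"
    using RF by (simp add: tinverse_of_def)
  have C_closed: "twisted_associator C \<in> tpower 3"
    unfolding twisted_associator_eq[OF C] by (intro tmult_closed LC \<Phi> RC)
  have "twisted_associator (F \<odot> C) =
      twist_left F \<odot> twisted_associator C \<odot> tinv 3 (twist_right F)"
    by (simp add: twisted_associator_eq F C tinvertible_tmult twist_left_tmult closed comm
        twist_right_tmult tinv_tmult right tmult_assoc)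
  then have "twisted_associator (F \<odot> C) = twisted_associator F \<longleftrightarrow> twisted_associator C = \<Phi>"
    unfolding twisted_associator_eq[OF F]
    using sandwich_eq_iff[OF LF(5) RF' LF(1) RF(2) C_closed \<Phi>] by simp
  also have "\<dots> \<longleftrightarrow> tone 3 \<odot> twisted_associator C \<odot> twist_right C = tone 3 \<odot> \<Phi> \<odot> twist_right C"
    by (rule sandwich_eq_iff[symmetric, OF tinverse_of_tone RC(5) tone_closed RC(1) C_closed \<Phi>])
  also have "\<dots> \<longleftrightarrow> twist_left C \<odot> \<Phi> = \<Phi> \<odot> twist_right C"
    using LC(1) RC(1) RC(4) \<Phi>
    by (simp add: tmult_tone_left C_closed) (simp add: twisted_associator_eq[OF C] tmult_assoc
        tmult_tone_right tmult_closed)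
  finally show ?thesis .
qed

lemma twisted_structures_eq_iff_compatible:
  assumes F: "twist F" and C: "twist C"
  shows "twisted_coproduct (F \<odot> C) = twisted_coproduct F \<and>
         twisted_associator (F \<odot> C) = twisted_associator F \<longleftrightarrow> compatible_twist C"
  using C twisted_coproduct_tmult_eq_iff[OF F[THEN twistD] C[THEN twistD]]
    twisted_associator_tmult_eq_iff[OF F[THEN twistD] C[THEN twistD]]
  unfolding compatible_twist_def twist_left_def twist_right_def tmult_assoc by blast

end

theorem proposition8:
  fixes scale :: "'k::field \<Rightarrow> 'h::ring_1 \<Rightarrow> 'h"
    and \<Delta> :: "'h \<Rightarrow> ('h list \<Rightarrow>\<^sub>0 'k) set"
    and \<epsilon> :: "'h \<Rightarrow> 'k"
    and \<Phi> F G :: "('h list \<Rightarrow>\<^sub>0 'k) set"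
  assumes "quasi_bialgebra scale \<Delta> \<epsilon> \<Phi>"
    and "quasi_bialgebra.twist scale \<epsilon> F"
    and "quasi_bialgebra.twist scale \<epsilon> G"
  shows "(quasi_bialgebra.twisted_coproduct scale \<Delta> F =
            quasi_bialgebra.twisted_coproduct scale \<Delta> G \<and>
          quasi_bialgebra.twisted_associator scale \<Delta> \<Phi> F =
            quasi_bialgebra.twisted_associator scale \<Delta> \<Phi> G) \<longleftrightarrow>
         (\<exists>C. quasi_bialgebra.compatible_twist scale \<Delta> \<epsilon> \<Phi> C \<and>
              G = k_algebra.tmult scale F C)"
proof -
  interpret quasi_bialgebra scale \<Delta> \<epsilon> \<Phi>
    by (rule assms(1))
  note F = assms(2) and G = assms(3)
  define C where "C = tinv 2 F \<odot> G"
  have C: "twist C" "G = F \<odot> C"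
    using twist_inverse_mult[OF F G]
      tinverse_of_cancel(1)[OF tinvertibleD(5)[OF twistD[OF F]] tinvertibleD(1)[OF twistD[OF G]]]
    by (simp_all add: C_def)
  show ?thesis
  proof
    assume "twisted_coproduct F = twisted_coproduct G \<and> twisted_associator F = twisted_associator G"
    then have "compatible_twist C"
      using twisted_structures_eq_iff_compatible[OF F C(1)] C(2) by simp
    then show "\<exists>C. compatible_twist C \<and> G = F \<odot> C"
      using C(2) by blast
  next
    assume "\<exists>C. compatible_twist C \<and> G = F \<odot> C"
    then obtain C where C: "compatible_twist C" "G = F \<odot> C"
      by blast
    then have "twist C"
      by (simp add: compatible_twist_def)
    from twisted_structures_eq_iff_compatible[OF F this]
    show "twisted_coproduct F = twisted_coproduct G \<and> twisted_associator F = twisted_associator G"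
      using C by simp
  qed
qed

end
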